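(* Let $X$ be the $1$-skeleton of a regular octahedron of side $1$, under the arc-length metric. Then for any nonzero real normed vector space $V$, $$1\ \le\ \mathrm{map\text{-}rad}(X,V)\ \le\ 7/6.$$ Moreover, the value of $\mathrm{map\text{-}rad}(X,V)$ is exactly $1$ if $V$ is $1$-dimensional; it is $\ge 1/\sqrt{3}+1/2$ if $V$ is $\mathbb{R}^n$ ($n\ge 2$) under the Euclidean norm; and it is exactly $7/6$ if $V$ is $\mathbb{R}^2$ under the norm having for unit circle a regular hexagon (centered at the origin).
   Context: The $1$-skeleton of the octahedron is the union of its $12$ closed edges (each of length $1$), and the arc-length metric is the path metric on this union: the distance between two points is the length of a shortest path in the $1$-skeleton joining them. A map $f:X\to Y$ of metric spaces is nonexpansive if $d(f(x_0),f(x_1))\le d(x_0,x_1)$ for all $x_0,x_1\in X$; $\mathbf{Metr}(X,Y)$ denotes the set of nonexpansive maps $X\to Y$. For a nonempty subset $A$ of a metric space $Y$, $\mathrm{rad}_Y(A)=\inf_{y\in Y}\sup_{a\in A} d(a,y)\in[0,+\infty]$. For metric spaces $X,Y$, $\mathrm{map\text{-}rad}(X,Y)=\sup_{f\in\mathbf{Metr}(X,Y)}\mathrm{rad}_Y(f(X))$. Normed vector spaces are regarded as metric spaces via the metric induced by the norm. *)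

theory Defs
  imports "HOL-Analysis.Analysis"
begin

text \<open>As in \<open>Metric_space\<close>, a metric space is given by its carrier \<open>M\<close> and its
  distance function \<open>d\<close>.\<close>

definition Metr :: "'a set \<Rightarrow> ('a \<Rightarrow> 'a \<Rightarrow> real) \<Rightarrow> 'b set \<Rightarrow> ('b \<Rightarrow> 'b \<Rightarrow> real) \<Rightarrow> ('a \<Rightarrow> 'b) set"
  where "Metr M d M' d' = {f \<in> M \<rightarrow> M'. \<forall>x0\<in>M. \<forall>x1\<in>M. d' (f x0) (f x1) \<le> d x0 x1}"

definition rad :: "'a set \<Rightarrow> ('a \<Rightarrow> 'a \<Rightarrow> real) \<Rightarrow> 'a set \<Rightarrow> ennreal"
  where "rad M d A = (INF y\<in>M. SUP a\<in>A. ennreal (d a y))"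

definition map_rad :: "'a set \<Rightarrow> ('a \<Rightarrow> 'a \<Rightarrow> real) \<Rightarrow> 'b set \<Rightarrow> ('b \<Rightarrow> 'b \<Rightarrow> real) \<Rightarrow> ennreal"
  where "map_rad M d M' d' = (SUP f\<in>Metr M d M' d'. rad M' d' (f ` M))"

text \<open>The length of a path is the supremum of the lengths of its inscribed polygons;
  it may be infinite.\<close>

definition path_length :: "(real \<Rightarrow> 'a::metric_space) \<Rightarrow> ennreal"
  where "path_length g =
    (SUP ts\<in>{ts. sorted ts \<and> set ts \<subseteq> {0..1}}.
      \<Sum>i<length ts - 1. ennreal (dist (g (ts ! i)) (g (ts ! Suc i))))"

text \<open>The conversion to a real number is harmless as long as any two points of \<open>S\<close> are joined
  in \<open>S\<close> by a path of finite length, which is so for the skeleton below.\<close>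

definition arc_dist :: "'a::metric_space set \<Rightarrow> 'a \<Rightarrow> 'a \<Rightarrow> real"
  where "arc_dist S x y =
    enn2real (INF g\<in>{g. path g \<and> path_image g \<subseteq> S \<and> pathstart g = x \<and> pathfinish g = y}.
      path_length g)"

definition octahedron_vertices :: "(real^3) set"
  where "octahedron_vertices = {axis i s | i s. s = 1 / sqrt 2 \<or> s = - (1 / sqrt 2)}"

text \<open>Two vertices are at distance \<open>1\<close> if they are adjacent, and at distance \<open>sqrt 2\<close> if they
  are opposite.\<close>

definition octahedron_skeleton :: "(real^3) set"
  where "octahedron_skeleton =
    \<Union>{closed_segment v w | v w. v \<in> octahedron_vertices \<and> w \<in> octahedron_vertices \<and> dist v w = 1}"

text \<open>Norms as functions, for normed spaces whose norm is not that of the type class instance.\<close>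

definition is_norm :: "('a::real_vector \<Rightarrow> real) \<Rightarrow> bool"
  where "is_norm N \<longleftrightarrow>
    (\<forall>x. N x = 0 \<longleftrightarrow> x = 0) \<and>
    (\<forall>c x. N (c *\<^sub>R x) = \<bar>c\<bar> * N x) \<and>
    (\<forall>x y. N (x + y) \<le> N x + N y)"

text \<open>A regular hexagon is understood here as a curve, that is, as the union of its six sides;
  the circumradius \<open>r\<close> and the rotation angle \<open>\<theta>\<close> are arbitrary.\<close>

definition hexagon_vertex :: "real \<Rightarrow> real \<Rightarrow> nat \<Rightarrow> real^2"
  where "hexagon_vertex r \<theta> k = vector [r * cos (\<theta> + k * pi / 3), r * sin (\<theta> + k * pi / 3)]"

definition regular_hexagon_at_origin :: "(real^2) set \<Rightarrow> bool"
  where "regular_hexagon_at_origin H \<longleftrightarrow>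
    (\<exists>r>0. \<exists>\<theta>. H = (\<Union>k<6. closed_segment (hexagon_vertex r \<theta> k) (hexagon_vertex r \<theta> (Suc k))))"

end

theory Submission
  imports Defs
begin

text \<open>Upper bound: the distances from a point of the skeleton to the six vertices add up to at
  most 7, so the mean of the images of the vertices is within \<open>7/6\<close> of every image point; in
  dimension 1 the diameter 2 of the skeleton gives the radius 1.

  Lower bounds: three disjoint edges contain all the vertices, and their midpoints are at mutual
  distance 2. Send the ends of the \<open>k\<close>-th of these edges to \<open>r w\<^sub>k\<close>, where the \<open>w\<^sub>k\<close> are unit
  vectors at mutual distance at most \<open>1/r\<close>, and its midpoint to \<open>(r + 1/2) w\<^sub>k\<close>. If there are
  functionals of norm 1 that attain their norms at the \<open>w\<^sub>k\<close> and have sum 0, no ball of radius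
  less than \<open>r + 1/2\<close> contains the image. In the Euclidean plane \<open>r = 1/sqrt 3\<close>; for the
  hexagonal norm, taking alternate edge midpoints of the hexagon as \<open>w\<^sub>k\<close>, \<open>r = 2/3\<close>.\<close>

section \<open>Bounding path lengths from above\<close>

text \<open>The function \<open>\<phi>\<close> stands for the length travelled up to a given time.
  Such a witness is easy to concatenate, unlike the supremum in \<open>path_length\<close>.\<close>

definition path_bound :: "'a::metric_space set \<Rightarrow> real \<Rightarrow> 'a \<Rightarrow> 'a \<Rightarrow> bool"
  where "path_bound S L x y \<longleftrightarrow>
    (\<exists>g \<phi>. path g \<and> path_image g \<subseteq> S \<and> pathstart g = x \<and> pathfinish g = y \<and>
      \<phi> 1 - \<phi> 0 \<le> L \<and> (\<forall>s t. 0 \<le> s \<and> s \<le> t \<and> t \<le> 1 \<longrightarrow> dist (g s) (g t) \<le> \<phi> t - \<phi> s))"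

text \<open>Each chord is at most an increment of \<open>\<phi>\<close>, and the increments
  telescope along any partition.\<close>

lemma path_length_le:
  fixes \<phi> :: "real \<Rightarrow> real"
  assumes "\<And>s t. 0 \<le> s \<Longrightarrow> s \<le> t \<Longrightarrow> t \<le> 1 \<Longrightarrow> dist (g s) (g t) \<le> \<phi> t - \<phi> s"
  shows "path_length g \<le> ennreal (\<phi> 1 - \<phi> 0)"
  unfolding path_length_def
proof (rule SUP_least, clarify)
  fix ts :: "real list" assume ts: "sorted ts" "set ts \<subseteq> {0..1}"
  have mono: "\<phi> s \<le> \<phi> t" if "0 \<le> s" "s \<le> t" "t \<le> 1" for s t
    using assms[OF that] zero_le_dist[of "g s" "g t"] by linarith
  have rng: "0 \<le> ts ! i" "ts ! i \<le> 1" if "i < length ts" for i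
    using ts(2) nth_mem[OF that] by auto
  have step: "dist (g (ts ! i)) (g (ts ! Suc i)) \<le> \<phi> (ts ! Suc i) - \<phi> (ts ! i)"
    if "i < length ts - 1" for i
    using that ts(1) rng by (intro assms) (auto simp: sorted_iff_nth_mono)
  show "(\<Sum>i<length ts - 1. ennreal (dist (g (ts ! i)) (g (ts ! Suc i)))) \<le> ennreal (\<phi> 1 - \<phi> 0)"
  proof (cases "ts = []")
    case True
    then show ?thesis by simp
  next
    case False
    have "(\<Sum>i<length ts - 1. dist (g (ts ! i)) (g (ts ! Suc i)))
        \<le> (\<Sum>i<length ts - 1. \<phi> (ts ! Suc i) - \<phi> (ts ! i))"
      using step by (intro sum_mono) auto
    also have "\<dots> = \<phi> (ts ! (length ts - 1)) - \<phi> (ts ! 0)"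
      by (rule sum_lessThan_telescope)
    also have "\<dots> \<le> \<phi> 1 - \<phi> 0"
      using False rng by (intro diff_mono mono) auto
    finally show ?thesis
      by (subst sum_ennreal) (auto intro: ennreal_leI)
  qed
qed

text \<open>The bound stays in \<open>ennreal\<close> because it also shows that the infimum is
  finite, which lower bounds on \<open>arc_dist\<close> require.\<close>

lemma path_bound_imp_INF_le:
  assumes "path_bound S L x y"
  shows "(INF g\<in>{g. path g \<and> path_image g \<subseteq> S \<and> pathstart g = x \<and> pathfinish g = y}. path_length g)
    \<le> ennreal L" and "0 \<le> L"
proof -
  obtain g \<phi> where g: "path g" "path_image g \<subseteq> S" "pathstart g = x" "pathfinish g = y"
    and \<phi>: "\<phi> 1 - \<phi> 0 \<le> L"
      "\<And>s t. 0 \<le> s \<Longrightarrow> s \<le> t \<Longrightarrow> t \<le> 1 \<Longrightarrow> dist (g s) (g t) \<le> \<phi> t - \<phi> s"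
    using assms unfolding path_bound_def by metis
  show "(INF g\<in>{g. path g \<and> path_image g \<subseteq> S \<and> pathstart g = x \<and> pathfinish g = y}. path_length g)
    \<le> ennreal L"
    using g \<phi>(1) by (intro INF_lower2[of g] order_trans[OF path_length_le[of g \<phi>]] \<phi>(2) ennreal_leI) auto
  show "0 \<le> L"
    using \<phi>(1) \<phi>(2)[of 0 1] zero_le_dist[of "g 0" "g 1"] by linarith
qed

lemma arc_dist_le: "path_bound S L x y \<Longrightarrow> arc_dist S x y \<le> L"
  unfolding arc_dist_def
  by (rule order_trans[OF enn2real_mono[OF path_bound_imp_INF_le(1)]])
    (auto dest: path_bound_imp_INF_le(2))

lemma path_bound_mono: "path_bound S L x y \<Longrightarrow> L \<le> L' \<Longrightarrow> path_bound S L' x y"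
  unfolding path_bound_def by (elim ex_forward) auto

lemma path_bound_segment:
  fixes p q :: "'a::real_normed_vector"
  assumes "closed_segment p q \<subseteq> S" and "dist p q \<le> L"
  shows "path_bound S L p q"
  unfolding path_bound_def
proof (intro exI conjI allI impI)
  show "path_image (linepath p q) \<subseteq> S" using assms by simp
  show "dist p q * 1 - dist p q * 0 \<le> L" using assms by simp
  fix s t :: real assume "0 \<le> s \<and> s \<le> t \<and> t \<le> 1"
  moreover have "linepath p q s - linepath p q t = (t - s) *\<^sub>R (p - q)"
    by (simp add: linepath_def algebra_simps)
  ultimately have "dist (linepath p q s) (linepath p q t) = (t - s) * dist p q"
    by (simp only: dist_norm norm_scaleR) simp
  then show "dist (linepath p q s) (linepath p q t) \<le> dist p q * t - dist p q * s"
    by (simp add: algebra_simps)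
qed auto

lemma path_bound_trans:
  assumes "path_bound S L x y" and "path_bound S M y z"
  shows "path_bound S (L + M) x z"
proof -
  obtain g \<phi> where g: "path g" "path_image g \<subseteq> S" "pathstart g = x" "pathfinish g = y"
    and \<phi>: "\<phi> 1 - \<phi> 0 \<le> L"
      "\<And>s t. 0 \<le> s \<Longrightarrow> s \<le> t \<Longrightarrow> t \<le> 1 \<Longrightarrow> dist (g s) (g t) \<le> \<phi> t - \<phi> s"
    using assms(1) unfolding path_bound_def by metis
  obtain h \<psi> where h: "path h" "path_image h \<subseteq> S" "pathstart h = y" "pathfinish h = z"
    and \<psi>: "\<psi> 1 - \<psi> 0 \<le> M"
      "\<And>s t. 0 \<le> s \<Longrightarrow> s \<le> t \<Longrightarrow> t \<le> 1 \<Longrightarrow> dist (h s) (h t) \<le> \<psi> t - \<psi> s"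
    using assms(2) unfolding path_bound_def by metis
  \<comment> \<open>The second length function is shifted to continue from \<open>\<phi> 1\<close>,
    the value of the first at the junction time 1/2.\<close>
  define \<rho> where "\<rho> t = (if t \<le> 1/2 then \<phi> (2 * t) else \<phi> 1 - \<psi> 0 + \<psi> (2 * t - 1))" for t :: real
  have "dist ((g +++ h) s) ((g +++ h) t) \<le> \<rho> t - \<rho> s" if "0 \<le> s" "s \<le> t" "t \<le> 1" for s t
  proof -
    have "dist (g (2 * s)) (h (2 * t - 1)) \<le> dist (g (2 * s)) (g 1) + dist (h 0) (h (2 * t - 1))"
      using g(4) h(3) dist_triangle[of "g (2 * s)" "h (2 * t - 1)" y]
      by (simp add: pathstart_def pathfinish_def)
    then show ?thesis
      using that \<phi>(2)[of "2 * s" "2 * t"] \<psi>(2)[of "2 * s - 1" "2 * t - 1"] \<phi>(2)[of "2 * s" 1]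
        \<psi>(2)[of 0 "2 * t - 1"]
      by (auto simp: joinpaths_def \<rho>_def)
  qed
  moreover have "\<rho> 1 - \<rho> 0 \<le> L + M"
    using \<phi>(1) \<psi>(1) by (simp add: \<rho>_def)
  moreover have "path (g +++ h)" "path_image (g +++ h) \<subseteq> S" "pathstart (g +++ h) = x"
      "pathfinish (g +++ h) = z"
    using g h by (auto simp: path_image_join)
  ultimately show ?thesis
    unfolding path_bound_def by blast
qed

section \<open>Bounding path lengths from below\<close>

lemma ennreal_plus_le: "ennreal (x + y) \<le> ennreal x + ennreal y"
proof -
  have "ennreal (x + y) \<le> ennreal (max 0 x + max 0 y)"
    by (intro ennreal_leI) linarith
  also have "\<dots> = ennreal x + ennreal y"
    by (subst ennreal_plus) (auto simp: max_def ennreal_neg)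
  finally show ?thesis .
qed

text \<open>The concatenation has at most one further term, the chord from the end of
  \<open>ts\<close> to the start of \<open>us\<close>.\<close>

lemma polygon_sum_append_le:
  fixes h :: "'a \<Rightarrow> 'a \<Rightarrow> ennreal"
  shows "(\<Sum>i<length ts - 1. h (ts ! i) (ts ! Suc i)) + (\<Sum>i<length us - 1. h (us ! i) (us ! Suc i))
    \<le> (\<Sum>i<length (ts @ us) - 1. h ((ts @ us) ! i) ((ts @ us) ! Suc i))"
proof -
  let ?h = "\<lambda>i. h ((ts @ us) ! i) ((ts @ us) ! Suc i)"
  have "(\<Sum>i<length ts - 1. h (ts ! i) (ts ! Suc i)) = sum ?h {..<length ts - 1}"
    by (intro sum.cong) (auto simp: nth_append)
  moreover have "(\<Sum>i<length us - 1. h (us ! i) (us ! Suc i)) = sum ?h ((+) (length ts) ` {..<length us - 1})"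
    by (subst sum.reindex) (auto simp: nth_append intro!: sum.cong)
  moreover have "sum ?h {..<length ts - 1} + sum ?h ((+) (length ts) ` {..<length us - 1})
      = sum ?h ({..<length ts - 1} \<union> (+) (length ts) ` {..<length us - 1})"
    by (intro sum.union_disjoint[symmetric]) auto
  moreover have "\<dots> \<le> sum ?h {..<length (ts @ us) - 1}"
    by (intro sum_mono2) auto
  ultimately show ?thesis by simp
qed

text \<open>Near a corner, \<open>f\<close> need not be nonexpansive for the ambient distance between two pieces;
  each point is only compared with the points near it, which share a piece with it.\<close>

lemma nonexpansive_pieces_path_length:
  fixes g :: "real \<Rightarrow> 'a::metric_space" and d :: "'b \<Rightarrow> 'b \<Rightarrow> real"
  assumes F: "finite F" "\<And>C. C \<in> F \<Longrightarrow> closed C"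
    and f: "\<And>C x y. C \<in> F \<Longrightarrow> x \<in> C \<Longrightarrow> y \<in> C \<Longrightarrow> d (f x) (f y) \<le> dist x y"
    and tri: "\<And>x y z. d x z \<le> d x y + d y z"
    and g: "path g" "path_image g \<subseteq> \<Union>F"
  shows "ennreal (d (f (pathstart g)) (f (pathfinish g))) \<le> path_length g"
proof -
  let ?len = "\<lambda>ts. \<Sum>i<length ts - 1. ennreal (dist (g (ts ! i)) (g (ts ! Suc i)))"
  \<comment> \<open>The guards make \<open>P\<close> vacuous on intervals that leave the unit
    interval, as small neighbourhoods of 0 and 1 do.\<close>
  define P where "P a b \<longleftrightarrow> 0 \<le> a \<longrightarrow> b \<le> 1 \<longrightarrow>
    (\<exists>ts. sorted ts \<and> set ts \<subseteq> {a..b} \<and> ennreal (d (f (g a)) (f (g b))) \<le> ?len ts)" for a b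
  have "P 0 1"
  \<comment> \<open>A property that passes to unions of adjacent intervals and holds on all short
    intervals around each point holds on the whole interval.\<close>
  proof (rule Bolzano)
    fix a b c assume P: "P a b" "P b c" and le: "a \<le> b" "b \<le> (c::real)"
    show "P a c"
      unfolding P_def
    proof (intro impI)
      assume ac: "0 \<le> a" "c \<le> 1"
      obtain ts where ts: "sorted ts" "set ts \<subseteq> {a..b}" "ennreal (d (f (g a)) (f (g b))) \<le> ?len ts"
        using P(1) ac le by (auto simp: P_def)
      obtain us where us: "sorted us" "set us \<subseteq> {b..c}" "ennreal (d (f (g b)) (f (g c))) \<le> ?len us"
        using P(2) ac le by (auto simp: P_def)
      have "ennreal (d (f (g a)) (f (g c))) \<le> ennreal (d (f (g a)) (f (g b)) + d (f (g b)) (f (g c)))"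
        by (intro ennreal_leI tri)
      also have "\<dots> \<le> ennreal (d (f (g a)) (f (g b))) + ennreal (d (f (g b)) (f (g c)))"
        by (simp add: ennreal_plus_le)
      also have "\<dots> \<le> ?len ts + ?len us"
        using ts(3) us(3) by (rule add_mono)
      also have "\<dots> \<le> ?len (ts @ us)"
        by (rule polygon_sum_append_le[where h = "\<lambda>s t. ennreal (dist (g s) (g t))"])
      finally show "\<exists>ts. sorted ts \<and> set ts \<subseteq> {a..c} \<and> ennreal (d (f (g a)) (f (g c))) \<le> ?len ts"
        using ts us le by (intro exI[of _ "ts @ us"]) (fastforce simp: sorted_append)
    qed
  next
    fix x :: real assume x: "0 \<le> x" "x \<le> 1"
    \<comment> \<open>By finiteness the pieces that miss \<open>g x\<close> have a closed union, so
      every piece through a point close enough to \<open>g x\<close> contains \<open>g x\<close> as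
      well.\<close>
    let ?C = "\<Union>{C \<in> F. g x \<notin> C}"
    have "closed ?C"
      using F by (intro closed_Union) auto
    then have "open (- ?C)" "g x \<in> - ?C"
      by auto
    then obtain e where "e > 0" "\<forall>y. dist y (g x) < e \<longrightarrow> y \<in> - ?C"
      unfolding open_dist by meson
    then have e: "e > 0" "\<And>y. dist y (g x) < e \<Longrightarrow> y \<notin> ?C"
      by auto
    obtain \<delta> where \<delta>: "\<delta> > 0" "\<And>s. s \<in> {0..1} \<Longrightarrow> dist s x < \<delta> \<Longrightarrow> dist (g s) (g x) < e"
      using g(1) x e(1) unfolding path_def continuous_on_iff by (metis atLeastAtMost_iff)
    have near: "d (f (g s)) (f (g x)) \<le> dist (g s) (g x)" "d (f (g x)) (f (g s)) \<le> dist (g x) (g s)"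
      if s: "s \<in> {0..1}" "dist s x < \<delta>" for s
    proof -
      have "g s \<in> \<Union>F" using g(2) s(1) by (simp add: path_image_def image_subset_iff del: Union_iff)
      then obtain C where "C \<in> F" "g s \<in> C" "g x \<in> C"
        using e(2)[OF \<delta>(2)[OF s]] by blast
      then show "d (f (g s)) (f (g x)) \<le> dist (g s) (g x)" "d (f (g x)) (f (g s)) \<le> dist (g x) (g s)"
        using f by blast+
    qed
    have "P a b" if "a \<le> x" "x \<le> b" "b - a < \<delta>" for a b
      unfolding P_def
    \<comment> \<open>The ends need not share a piece with each other, but each shares one with the
      intermediate point \<open>x\<close>.\<close>
    proof (intro impI exI[of _ "[a, x, b]"] conjI)
      assume ab: "0 \<le> a" "b \<le> 1"
      have "d (f (g a)) (f (g b)) \<le> d (f (g a)) (f (g x)) + d (f (g x)) (f (g b))"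
        by (rule tri)
      also have "\<dots> \<le> dist (g a) (g x) + dist (g x) (g b)"
        using that ab by (intro add_mono near) (auto simp: dist_real_def)
      finally show "ennreal (d (f (g a)) (f (g b))) \<le> ?len [a, x, b]"
        by (simp add: lessThan_Suc ennreal_leI add.commute flip: ennreal_plus)
    qed (use that in auto)
    with \<delta>(1) show "\<exists>\<delta>>0. \<forall>a b. a \<le> x \<and> x \<le> b \<and> b - a < \<delta> \<longrightarrow> P a b" by blast
  qed simp
  then show ?thesis
    unfolding P_def path_length_def pathstart_def pathfinish_def
    by (auto intro: SUP_upper2)
qed

text \<open>The path bound makes the infimum of lengths finite; \<open>enn2real\<close> would send
  an infinite one to 0.\<close>

lemma nonexpansive_pieces_arc_dist:
  fixes d :: "'b \<Rightarrow> 'b \<Rightarrow> real"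
  assumes F: "finite F" "\<And>C. C \<in> F \<Longrightarrow> closed C"
    and f: "\<And>C x y. C \<in> F \<Longrightarrow> x \<in> C \<Longrightarrow> y \<in> C \<Longrightarrow> d (f x) (f y) \<le> dist x y"
    and tri: "\<And>x y z. d x z \<le> d x y + d y z"
    and xy: "path_bound (\<Union>F) L x y"
  shows "d (f x) (f y) \<le> arc_dist (\<Union>F) x y"
proof -
  let ?I = "INF g\<in>{g. path g \<and> path_image g \<subseteq> \<Union>F \<and> pathstart g = x \<and> pathfinish g = y}. path_length g"
  have "ennreal (d (f x) (f y)) \<le> ?I"
    using nonexpansive_pieces_path_length[of F d f, OF F f tri] by (intro INF_greatest) auto
  moreover have "?I < top"
    using path_bound_imp_INF_le(1)[OF xy] by (simp add: ennreal_less_top order_le_less_trans)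
  ultimately show ?thesis
    unfolding arc_dist_def by (smt (verit) enn2real_mono enn2real_ennreal enn2real_nonneg)
qed

section \<open>Edges and distances in the skeleton\<close>

text \<open>Only used for \<open>s\<close> equal to 1 or -1.\<close>

definition vert :: "3 \<Rightarrow> real \<Rightarrow> real^3"
  where "vert i s = axis i (s / sqrt 2)"

lemma octahedron_vertices_eq: "octahedron_vertices = {vert i s | i s. \<bar>s\<bar> = 1}"
proof -
  have "{axis i s | i s. s = 1 / sqrt 2 \<or> s = - (1 / sqrt 2)} = {axis i (s / sqrt 2) | i s. s = 1 \<or> s = - 1}"
    by (auto; metis minus_divide_left)
  moreover have "\<bar>s\<bar> = 1 \<longleftrightarrow> s = 1 \<or> s = - 1" for s :: real
    by auto
  ultimately show ?thesis
    unfolding octahedron_vertices_def vert_def by simp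
qed

text \<open>The squared distance is 0 or 2 on one axis, and 1/2 + 1/2 between two axes.\<close>

lemma dist_vert:
  assumes "\<bar>s\<bar> = 1" "\<bar>s'\<bar> = 1"
  shows "dist (vert i s) (vert j s') = 1 \<longleftrightarrow> i \<noteq> j"
proof -
  have "(dist (vert i s) (vert j s'))\<^sup>2 = (if i = j then (s - s')\<^sup>2 / 2 else 1)"
    unfolding vert_def dist_norm power2_norm_eq_inner using assms
    by (auto simp: inner_diff inner_axis_axis power2_eq_square field_simps abs_if split: if_splits)
  moreover have "(s - s')\<^sup>2 = 0 \<or> (s - s')\<^sup>2 = 4"
    using assms by (auto simp: abs_if split: if_splits)
  moreover have "dist (vert i s) (vert j s') \<noteq> - 1"
    using zero_le_dist[of "vert i s" "vert j s'"] by linarith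
  ultimately show ?thesis
    by (auto simp: power2_eq_1_iff split: if_splits)
qed

definition edges :: "(real^3) set set"
  where "edges = {closed_segment (vert i s) (vert j s') | i s j s'. i \<noteq> j \<and> \<bar>s\<bar> = 1 \<and> \<bar>s'\<bar> = 1}"

lemma octahedron_skeleton_eq: "octahedron_skeleton = \<Union>edges"
  unfolding octahedron_skeleton_def octahedron_vertices_eq edges_def
  by (intro arg_cong[where f = Union]) (auto simp: dist_vert; metis dist_vert)

lemma finite_edges: "finite edges"
proof -
  have "edges \<subseteq> (\<lambda>(i, s, j, s'). closed_segment (vert i s) (vert j s')) ` (UNIV \<times> {1, -1} \<times> UNIV \<times> {1, -1})"
    unfolding edges_def by (auto simp: abs_if image_iff split: if_splits)
  then show ?thesis by (rule finite_subset) auto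
qed

lemma closed_edges: "C \<in> edges \<Longrightarrow> closed C"
  by (auto simp: edges_def)

definition edge_pt :: "3 \<Rightarrow> real \<Rightarrow> 3 \<Rightarrow> real \<Rightarrow> real \<Rightarrow> real^3"
  where "edge_pt i s j s' t = (1 - t) *\<^sub>R vert i s + t *\<^sub>R vert j s'"

lemma edge_pt_0: "edge_pt i s j s' 0 = vert i s"
  by (simp add: edge_pt_def)

lemma edge_pt_1: "edge_pt i s j s' 1 = vert j s'"
  by (simp add: edge_pt_def)

lemma dist_edge_pt:
  assumes "i \<noteq> j" "\<bar>s\<bar> = 1" "\<bar>s'\<bar> = 1"
  shows "dist (edge_pt i s j s' t) (edge_pt i s j s' t') = \<bar>t - t'\<bar>"
proof -
  have "edge_pt i s j s' t - edge_pt i s j s' t' = (t' - t) *\<^sub>R (vert i s - vert j s')"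
    by (simp add: edge_pt_def algebra_simps)
  moreover have "norm (vert i s - vert j s') = 1"
    using dist_vert[of s s' i j] assms by (simp add: dist_norm)
  ultimately show ?thesis
    by (simp add: dist_norm)
qed

lemma edges_cases:
  assumes "C \<in> edges"
  obtains i s j s' where "i \<noteq> j" "\<bar>s\<bar> = 1" "\<bar>s'\<bar> = 1" "C = edge_pt i s j s' ` {0..1}"
  using assms unfolding edges_def edge_pt_def closed_segment_image_interval by auto

lemma octahedron_skeleton_cases:
  assumes "x \<in> octahedron_skeleton"
  obtains i s j s' t where "i \<noteq> j" "\<bar>s\<bar> = 1" "\<bar>s'\<bar> = 1" "0 \<le> t" "t \<le> 1" "x = edge_pt i s j s' t"
  using assms unfolding octahedron_skeleton_eq by (auto elim!: edges_cases)

lemma edge_pt_in_skeleton: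
  assumes "i \<noteq> j" "\<bar>s\<bar> = 1" "\<bar>s'\<bar> = 1" "0 \<le> t" "t \<le> 1"
  shows "edge_pt i s j s' t \<in> octahedron_skeleton"
  unfolding octahedron_skeleton_eq edges_def closed_segment_image_interval edge_pt_def
  using assms by fastforce

lemma vert_in_skeleton: "\<bar>s\<bar> = 1 \<Longrightarrow> vert i s \<in> octahedron_skeleton"
  \<comment> \<open>Arithmetic in the type \<open>3\<close> is modulo 3, so \<open>i + 1\<close> is
    another axis and the vertex is the start of an edge.\<close>
  using edge_pt_in_skeleton[of i "i + 1" s 1 0] by (simp add: edge_pt_0)

abbreviation skel_bound :: "real \<Rightarrow> real^3 \<Rightarrow> real^3 \<Rightarrow> bool"
  where "skel_bound \<equiv> path_bound octahedron_skeleton"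

lemma skel_bound_edge:
  assumes "i \<noteq> j" "\<bar>s\<bar> = 1" "\<bar>s'\<bar> = 1" "0 \<le> t" "t \<le> 1" "0 \<le> t'" "t' \<le> 1" "\<bar>t - t'\<bar> \<le> L"
  shows "skel_bound L (edge_pt i s j s' t) (edge_pt i s j s' t')"
proof (rule path_bound_segment)
  let ?C = "closed_segment (vert i s) (vert j s')"
  have "edge_pt i s j s' t \<in> ?C" "edge_pt i s j s' t' \<in> ?C"
    using assms unfolding closed_segment_image_interval edge_pt_def by auto
  then have "closed_segment (edge_pt i s j s' t) (edge_pt i s j s' t') \<subseteq> ?C"
    by (simp add: subset_closed_segment)
  also have "\<dots> \<subseteq> octahedron_skeleton"
    using assms unfolding octahedron_skeleton_eq edges_def by blast
  finally show "closed_segment (edge_pt i s j s' t) (edge_pt i s j s' t') \<subseteq> octahedron_skeleton" .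
  show "dist (edge_pt i s j s' t) (edge_pt i s j s' t') \<le> L"
    using assms by (simp add: dist_edge_pt)
qed

lemma skel_bound_edge_vert:
  assumes "i \<noteq> j" "\<bar>s\<bar> = 1" "\<bar>s'\<bar> = 1" "0 \<le> t" "t \<le> 1"
  shows "skel_bound t (edge_pt i s j s' t) (vert i s)" "skel_bound t (vert i s) (edge_pt i s j s' t)"
    "skel_bound (1 - t) (edge_pt i s j s' t) (vert j s')" "skel_bound (1 - t) (vert j s') (edge_pt i s j s' t)"
  using skel_bound_edge[OF assms, of 0 t] skel_bound_edge[OF assms, of 1 "1 - t"]
    skel_bound_edge[OF assms(1-3), of 0 t t] skel_bound_edge[OF assms(1-3), of 1 t "1 - t"] assms
  by (simp_all add: edge_pt_0 edge_pt_1)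

text \<open>The last assumption excludes opposite vertices; for equal ones a constant path
  serves.\<close>

lemma skel_bound_vert:
  assumes "\<bar>s\<bar> = 1" "\<bar>s'\<bar> = 1" "i = j \<Longrightarrow> s = s'"
  shows "skel_bound 1 (vert i s) (vert j s')"
proof (cases "i = j")
  case True
  then show ?thesis
    using assms skel_bound_edge[of i "i + 1" s s 0 0 1] by (simp add: edge_pt_0)
next
  case False
  then show ?thesis
    using assms skel_bound_edge[of i j s s' 0 1 1] by (simp add: edge_pt_0 edge_pt_1)
qed

lemma skel_bound_diameter:
  assumes "x \<in> octahedron_skeleton" "y \<in> octahedron_skeleton"
  shows "skel_bound 2 x y"
proof -
  obtain i s j s' t where x: "i \<noteq> j" "\<bar>s\<bar> = 1" "\<bar>s'\<bar> = 1" "0 \<le> t" "t \<le> 1" "x = edge_pt i s j s' t"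
    using assms(1) by (elim octahedron_skeleton_cases)
  obtain k q l q' r where y: "k \<noteq> l" "\<bar>q\<bar> = 1" "\<bar>q'\<bar> = 1" "0 \<le> r" "r \<le> 1" "y = edge_pt k q l q' r"
    using assms(2) by (elim octahedron_skeleton_cases)
  note xb = skel_bound_edge_vert[OF x(1-5), folded x(6)]
    and yb = skel_bound_edge_vert[OF y(1-5), folded y(6)]
  \<comment> \<open>Each matching of the ends of the two edges gives two paths of total length at most 4,
    as soon as matched vertices are not opposite.\<close>
  have route: "skel_bound (L + 1 + M) x y"
    if "skel_bound L x (vert a p)" "skel_bound M (vert b p') y" "\<bar>p\<bar> = 1" "\<bar>p'\<bar> = 1" "a = b \<Longrightarrow> p = p'"
    for L M a b p p'
    using path_bound_trans[OF path_bound_trans[OF that(1) skel_bound_vert[OF that(3-5)]] that(2)] .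
  \<comment> \<open>An opposite pair in one matching means that the two edges share that axis there;
    their other axes differ from it, so the other matching pairs only vertices on distinct
    axes.\<close>
  consider "i = k \<longrightarrow> s = q" "j = l \<longrightarrow> s' = q'" | "i = l \<longrightarrow> s = q'" "j = k \<longrightarrow> s' = q"
    using x(1) y(1) by metis
  then show ?thesis
  proof cases
    case 1
    then have "skel_bound (t + 1 + r) x y" "skel_bound ((1 - t) + 1 + (1 - r)) x y"
      using x(2,3) y(2,3) route[OF xb(1) yb(2)] route[OF xb(3) yb(4)] by auto
    then show ?thesis
      by (cases "t + r \<le> 1") (auto elim: path_bound_mono)
  next
    case 2
    then have "skel_bound (t + 1 + (1 - r)) x y" "skel_bound ((1 - t) + 1 + r) x y"
      using x(2,3) y(2,3) route[OF xb(1) yb(4)] route[OF xb(3) yb(2)] by auto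
    then show ?thesis
      by (cases "t \<le> r") (auto elim: path_bound_mono)
  qed
qed

text \<open>The edges are the finitely many closed pieces, and the diameter bound gives a path of
  finite length between any two points, so checking single edges suffices.\<close>

lemma Metr_skeletonI:
  fixes f :: "real^3 \<Rightarrow> 'b" and d :: "'b \<Rightarrow> 'b \<Rightarrow> real"
  assumes f: "\<And>i j s s' t t'. i \<noteq> j \<Longrightarrow> \<bar>s\<bar> = 1 \<Longrightarrow> \<bar>s'\<bar> = 1 \<Longrightarrow> 0 \<le> t \<Longrightarrow> t \<le> 1 \<Longrightarrow> 0 \<le> t' \<Longrightarrow> t' \<le> 1
      \<Longrightarrow> d (f (edge_pt i s j s' t)) (f (edge_pt i s j s' t')) \<le> \<bar>t - t'\<bar>"
    and tri: "\<And>x y z. d x z \<le> d x y + d y z"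
  shows "f \<in> Metr octahedron_skeleton (arc_dist octahedron_skeleton) UNIV d"
proof -
  have "d (f x) (f y) \<le> dist x y" if "C \<in> edges" "x \<in> C" "y \<in> C" for C x y
    using that by (auto elim!: edges_cases simp: dist_edge_pt intro!: f)
  then have "d (f x) (f y) \<le> arc_dist octahedron_skeleton x y"
    if "x \<in> octahedron_skeleton" "y \<in> octahedron_skeleton" for x y
    using skel_bound_diameter[OF that] finite_edges closed_edges tri
    unfolding octahedron_skeleton_eq by (intro nonexpansive_pieces_arc_dist) auto
  then show ?thesis
    by (simp add: Metr_def)
qed

section \<open>Norms as functions, and the upper bound 7/6\<close>

lemma is_norm_norm: "is_norm (norm :: 'a::real_normed_vector \<Rightarrow> real)"
  by (auto simp: is_norm_def norm_triangle_ineq)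

lemma is_norm_0: "is_norm N \<Longrightarrow> N 0 = 0"
  by (simp add: is_norm_def)

lemma is_norm_scaleR: "is_norm N \<Longrightarrow> N (c *\<^sub>R x) = \<bar>c\<bar> * N x"
  by (simp add: is_norm_def)

lemma is_norm_triangle: "is_norm N \<Longrightarrow> N (x + y) \<le> N x + N y"
  by (simp add: is_norm_def)

lemma is_norm_diff_triangle: "is_norm N \<Longrightarrow> N (x - z) \<le> N (x - y) + N (y - z)"
  using is_norm_triangle[of N "x - y" "y - z"] by simp

lemma is_norm_minus: "is_norm N \<Longrightarrow> N (- x) = N x"
  using is_norm_scaleR[of N "- 1" x] by simp

lemma is_norm_nonneg:
  assumes "is_norm N" shows "0 \<le> N x"
  using is_norm_triangle[OF assms, of x "- x"] is_norm_minus[OF assms, of x] is_norm_0[OF assms]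
  by simp

lemma is_norm_sum_le:
  assumes "is_norm N" shows "N (sum f A) \<le> (\<Sum>a\<in>A. N (f a))"
proof (induction A rule: infinite_finite_induct)
  case (insert a A)
  then show ?case
    using is_norm_triangle[OF assms, of "f a" "sum f A"] by simp
qed (use is_norm_0[OF assms] in auto)

text \<open>The vertices are taken in opposite pairs. For a point on an edge, the pairs on the two
  axes of the edge contribute at most 2 each to the sum of distances, the third pair at most
  3.\<close>

lemma map_rad_skeleton_le_7_6:
  fixes N :: "'a::real_vector \<Rightarrow> real"
  assumes N: "is_norm N"
  shows "map_rad octahedron_skeleton (arc_dist octahedron_skeleton) UNIV (\<lambda>x y. N (x - y)) \<le> ennreal (7 / 6)"
  unfolding map_rad_def rad_def
proof (intro SUP_least)
  fix f assume "f \<in> Metr octahedron_skeleton (arc_dist octahedron_skeleton) UNIV (\<lambda>x y. N (x - y))"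
  then have f: "N (f x - f y) \<le> L"
    if "skel_bound L x y" "x \<in> octahedron_skeleton" "y \<in> octahedron_skeleton" for x y L
    using that(2,3) arc_dist_le[OF that(1)] by (auto simp: Metr_def intro: order_trans)
  let ?y = "(1 / 6) *\<^sub>R (\<Sum>i\<in>UNIV. f (vert i 1) + f (vert i (- 1)))"
  have "N (f x - ?y) \<le> 7 / 6" if "x \<in> octahedron_skeleton" for x
    using that
  proof (rule octahedron_skeleton_cases)
    fix i s j s' t assume e: "i \<noteq> j" "\<bar>s\<bar> = 1" "\<bar>s'\<bar> = 1" "0 \<le> t" "t \<le> 1" and x: "x = edge_pt i s j s' t"
    note b = skel_bound_edge_vert[OF e, folded x]
    define h where "h k = N (f x - f (vert k 1)) + N (f x - f (vert k (- 1)))" for k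
    have via_i: "N (f x - f (vert k q)) \<le> t + 1" if "\<bar>q\<bar> = 1" "k \<noteq> i" for k q
      using that e \<open>x \<in> octahedron_skeleton\<close> vert_in_skeleton
      by (intro f path_bound_trans[OF b(1)] skel_bound_vert) auto
    have via_j: "N (f x - f (vert k q)) \<le> 1 - t + 1" if "\<bar>q\<bar> = 1" "k \<noteq> j" for k q
      using that e \<open>x \<in> octahedron_skeleton\<close> vert_in_skeleton
      by (intro f path_bound_trans[OF b(3)] skel_bound_vert) auto
    have ends: "N (f x - f (vert i s)) \<le> t" "N (f x - f (vert j s')) \<le> 1 - t"
      using e \<open>x \<in> octahedron_skeleton\<close> vert_in_skeleton by (intro f b; simp)+
    have hi: "h i \<le> 2"
      using ends(1) via_j[of 1 i] via_j[of "- 1" i] e(1,2)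
      by (auto simp: h_def abs_if split: if_splits)
    have hj: "h j \<le> 2"
      using ends(2) via_i[of 1 j] via_i[of "- 1" j] e(1,3)
      by (auto simp: h_def abs_if split: if_splits)
    obtain k where k: "k \<noteq> i" "k \<noteq> j"
      using card_mono[of "{i, j}" "UNIV :: 3 set"] e(1) by fastforce
    \<comment> \<open>One distance is bounded through \<open>vert i s\<close>, the other through
      \<open>vert j s'\<close>: (t + 1) + (2 - t) = 3.\<close>
    have hk: "h k \<le> 3"
      using via_i[of 1 k] via_i[of "- 1" k] via_j[of 1 k] via_j[of "- 1" k] k
      by (auto simp: h_def)
    have "card {i, j, k} = card (UNIV :: 3 set)"
      using e(1) k by simp
    then have U: "(UNIV :: 3 set) = {i, j, k}"
      by (metis card_subset_eq finite subset_UNIV)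
    have h: "N ((f x - f (vert l 1)) + (f x - f (vert l (- 1)))) \<le> h l" for l
      unfolding h_def by (rule is_norm_triangle[OF N])
    have "(\<Sum>l\<in>UNIV. (f x - f (vert l 1)) + (f x - f (vert l (- 1))))
        = (3 *\<^sub>R f x + 3 *\<^sub>R f x) - (\<Sum>l\<in>UNIV. f (vert l 1) + f (vert l (- 1)))"
      by (simp add: sum.distrib sum_subtractf sum_constant_scaleR)
    also have "3 *\<^sub>R f x + 3 *\<^sub>R f x = 6 *\<^sub>R f x"
      by (simp flip: scaleR_add_left)
    finally have "f x - ?y = (1 / 6) *\<^sub>R (\<Sum>l\<in>UNIV. (f x - f (vert l 1)) + (f x - f (vert l (- 1))))"
      by (simp add: scaleR_diff_right)
    also have "N \<dots> \<le> (1 / 6) * (\<Sum>l\<in>UNIV. h l)"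
      using order_trans[OF is_norm_sum_le[OF N] sum_mono[OF h]] by (simp add: is_norm_scaleR[OF N])
    also have "\<dots> \<le> 7 / 6"
      unfolding U using e(1) k hi hj hk by simp
    finally show ?thesis .
  qed
  then show "(INF y\<in>UNIV. SUP a\<in>f ` octahedron_skeleton. ennreal (N (a - y))) \<le> ennreal (7 / 6)"
    by (intro INF_lower2[of ?y] SUP_least) (auto intro: ennreal_leI)
qed

section \<open>The lower bound 1, and dimension 1\<close>

lemma map_rad_geI:
  assumes "f \<in> Metr M d M' d'" "\<And>y. y \<in> M' \<Longrightarrow> \<exists>x\<in>M. L \<le> d' (f x) y"
  shows "ennreal L \<le> map_rad M d M' d'"
proof -
  have "ennreal L \<le> (SUP a\<in>f ` M. ennreal (d' a y))" if "y \<in> M'" for y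
    using assms(2)[OF that] by (force intro!: SUP_upper2 ennreal_leI)
  then show ?thesis
    unfolding map_rad_def rad_def by (intro SUP_upper2[OF assms(1)] INF_greatest)
qed

text \<open>A rescaled coordinate sends two opposite vertices to opposite unit vectors, at distance
  2, so no centre is at distance less than 1 from both.\<close>

lemma map_rad_skeleton_ge_1:
  fixes v :: "'v::real_normed_vector"
  assumes "v \<noteq> 0"
  shows "1 \<le> map_rad octahedron_skeleton (arc_dist octahedron_skeleton) (UNIV :: 'v set) dist"
proof -
  define f where "f x = (sqrt 2 * x $ 1) *\<^sub>R sgn v" for x :: "real^3"
  have "f \<in> Metr octahedron_skeleton (arc_dist octahedron_skeleton) UNIV dist"
  proof (rule Metr_skeletonI)
    fix i j :: 3 and s s' t t' :: real
    assume *: "i \<noteq> j" "\<bar>s\<bar> = 1" "\<bar>s'\<bar> = 1"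
    \<comment> \<open>The slope of the coordinate along the edge; as \<open>i \<noteq> j\<close>, at
      most one of the two terms is nonzero.\<close>
    define c where "c = (if j = 1 then s' else 0) - (if i = 1 then s else 0)"
    have "sqrt 2 * edge_pt i s j s' t $ 1 - sqrt 2 * edge_pt i s j s' t' $ 1 = (t - t') * c"
      by (simp add: edge_pt_def vert_def axis_def c_def algebra_simps)
    then have "f (edge_pt i s j s' t) - f (edge_pt i s j s' t') = ((t - t') * c) *\<^sub>R sgn v"
      by (simp add: f_def flip: scaleR_diff_left)
    then have "dist (f (edge_pt i s j s' t)) (f (edge_pt i s j s' t')) = \<bar>t - t'\<bar> * \<bar>c\<bar>"
      using assms by (simp add: dist_norm abs_mult norm_sgn)
    also have "\<bar>c\<bar> \<le> 1" using * by (auto simp: c_def)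
    then have "\<bar>t - t'\<bar> * \<bar>c\<bar> \<le> \<bar>t - t'\<bar>" by (simp add: mult_left_le)
    finally show "dist (f (edge_pt i s j s' t)) (f (edge_pt i s j s' t')) \<le> \<bar>t - t'\<bar>" .
  qed (rule dist_triangle)
  moreover have "\<exists>x\<in>octahedron_skeleton. 1 \<le> dist (f x) y" for y
  proof -
    have "f (vert 1 1) = sgn v" "f (vert 1 (- 1)) = - sgn v"
      by (simp_all add: f_def vert_def axis_def)
    then have "dist (f (vert 1 1)) (f (vert 1 (- 1))) = 2"
      using assms norm_scaleR[of 2 "sgn v"] by (simp add: dist_norm norm_sgn scaleR_2)
    then have "1 \<le> dist (f (vert 1 1)) y \<or> 1 \<le> dist (f (vert 1 (- 1))) y"
      using dist_triangle2[of "f (vert 1 1)" "f (vert 1 (- 1))" y] by linarith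
    then show ?thesis
      using vert_in_skeleton[of 1 1] vert_in_skeleton[of "- 1" 1] by auto
  qed
  ultimately show ?thesis
    using map_rad_geI[of f _ _ UNIV dist 1] by simp
qed

lemma map_rad_skeleton_dim_1:
  assumes "dim (UNIV :: 'v::real_normed_vector set) = 1"
  shows "map_rad octahedron_skeleton (arc_dist octahedron_skeleton) (UNIV :: 'v set) dist = 1"
proof (rule antisym)
  \<comment> \<open>In infinite dimension \<open>dim\<close> would be 0, like \<open>card\<close> of
    an infinite basis; the value 1 does give a one-element basis.\<close>
  obtain B :: "'v set" where B: "independent B" "span B = UNIV" "card B = 1"
    using basis_exists[of "UNIV :: 'v set"] assms by (metis top.extremum_uniqueI)
  then obtain b where b: "B = {b}" by (auto simp: card_1_singleton_iff)
  with B have "b \<noteq> 0" by auto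
  then show "1 \<le> map_rad octahedron_skeleton (arc_dist octahedron_skeleton) (UNIV :: 'v set) dist"
    by (rule map_rad_skeleton_ge_1)
  have ex: "\<exists>c. x = c *\<^sub>R sgn b" for x
  proof -
    obtain k where "x = k *\<^sub>R b"
      using B(2) b by (metis UNIV_I span_breakdown_eq span_empty singletonD eq_iff_diff_eq_0)
    then show ?thesis
      using \<open>b \<noteq> 0\<close> by (intro exI[of _ "k * norm b"]) (simp add: sgn_div_norm)
  qed
  then obtain c where c: "\<And>x. x = c x *\<^sub>R sgn b" by metis
  have dist_c: "dist (p *\<^sub>R sgn b) (q *\<^sub>R sgn b) = \<bar>p - q\<bar>" for p q
    using \<open>b \<noteq> 0\<close> by (simp add: dist_norm norm_sgn flip: scaleR_diff_left)
  show "map_rad octahedron_skeleton (arc_dist octahedron_skeleton) (UNIV :: 'v set) dist \<le> 1"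
    unfolding map_rad_def rad_def
  proof (intro SUP_least)
    fix f :: "real^3 \<Rightarrow> 'v"
    assume f: "f \<in> Metr octahedron_skeleton (arc_dist octahedron_skeleton) UNIV dist"
    let ?S = "(c \<circ> f) ` octahedron_skeleton"
    have diam: "\<bar>c (f x) - c (f y)\<bar> \<le> 2" if "x \<in> octahedron_skeleton" "y \<in> octahedron_skeleton" for x y
    proof -
      have "\<bar>c (f x) - c (f y)\<bar> = dist (f x) (f y)"
        using dist_c[of "c (f x)" "c (f y)"] c[of "f x"] c[of "f y"] by simp
      also have "\<dots> \<le> arc_dist octahedron_skeleton x y"
        using f that by (auto simp: Metr_def)
      also have "\<dots> \<le> 2"
        using that by (intro arc_dist_le skel_bound_diameter)
      finally show ?thesis .
    qed
    have ne: "?S \<noteq> {}"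
      using vert_in_skeleton[of 1 1] by auto
    \<comment> \<open>A set of reals of diameter at most 2 lies in the interval of length 2 that
      starts at its infimum; the centre is the midpoint of that interval.\<close>
    have "\<bar>c (f x) - (Inf ?S + 1)\<bar> \<le> 1" if x: "x \<in> octahedron_skeleton" for x
    proof -
      have lower: "c (f x) - 2 \<le> r" if "r \<in> ?S" for r
        using that diam[OF x] by force
      have "Inf ?S \<le> c (f x)"
        using x lower by (intro cInf_lower bdd_belowI[of _ "c (f x) - 2"]) auto
      moreover have "c (f x) - 2 \<le> Inf ?S"
        using ne lower by (rule cInf_greatest)
      ultimately show ?thesis by linarith
    qed
    then have "dist (f x) ((Inf ?S + 1) *\<^sub>R sgn b) \<le> 1" if "x \<in> octahedron_skeleton" for x
      using that c[of "f x"] dist_c[of "c (f x)" "Inf ?S + 1"] by simp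
    then show "(INF y\<in>UNIV. SUP a\<in>f ` octahedron_skeleton. ennreal (dist a y)) \<le> 1"
      by (intro INF_lower2[of "(Inf ?S + 1) *\<^sub>R sgn b"] SUP_least) auto
  qed
qed

section \<open>The folding map and the triangle bound\<close>

text \<open>On the skeleton this is the barycentric coordinate at \<open>vert k q\<close>: 1 there,
  0 at the other vertices, affine on each edge. The positive part separates the two vertices of an
  axis.\<close>

definition bary :: "3 \<Rightarrow> real \<Rightarrow> real^3 \<Rightarrow> real"
  where "bary k q x = max 0 (q * (sqrt 2 * x $ k))"

lemma bary_edge_pt:
  assumes "i \<noteq> j" "\<bar>s\<bar> = 1" "\<bar>s'\<bar> = 1" "\<bar>q\<bar> = 1" "0 \<le> t" "t \<le> 1"
  shows "bary k q (edge_pt i s j s' t) = (if k = i \<and> q = s then 1 - t else if k = j \<and> q = s' then t else 0)"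
proof -
  have "sqrt 2 * edge_pt i s j s' t $ k = (if k = i then (1 - t) * s else if k = j then t * s' else 0)"
    using assms(1) by (auto simp: edge_pt_def vert_def axis_def)
  moreover have "s = 1 \<or> s = - 1" "s' = 1 \<or> s' = - 1" "q = 1 \<or> q = - 1"
    using assms by auto
  ultimately show ?thesis
    unfolding bary_def using assms(1,5,6) by (elim disjE) simp_all
qed

text \<open>The three disjoint edges join \<open>e\<^sub>1\<close> to \<open>e\<^sub>2\<close>, \<open>- e\<^sub>1\<close> to \<open>e\<^sub>3\<close>, and \<open>- e\<^sub>2\<close> to \<open>- e\<^sub>3\<close>. The two
  barycentric coordinates on such an edge add up to 1, and their minimum produces the fold at its
  midpoint.\<close>

definition fold_map :: "real \<Rightarrow> (3 \<Rightarrow> 'a::real_vector) \<Rightarrow> real^3 \<Rightarrow> 'a"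
  where "fold_map r w x =
    (r * (bary 1 1 x + bary 2 1 x) + min (bary 1 1 x) (bary 2 1 x)) *\<^sub>R w 1 +
    (r * (bary 1 (- 1) x + bary 3 1 x) + min (bary 1 (- 1) x) (bary 3 1 x)) *\<^sub>R w 2 +
    (r * (bary 2 (- 1) x + bary 3 (- 1) x) + min (bary 2 (- 1) x) (bary 3 (- 1) x)) *\<^sub>R w 3"

text \<open>Tells on which of the three disjoint edges \<open>vert i s\<close> lies, numbered as the
  terms of \<open>fold_map\<close>.\<close>

definition fold_class :: "3 \<Rightarrow> real \<Rightarrow> 3"
  where "fold_class i s = (if s = 1 then (if i = 3 then 2 else 1) else (if i = 1 then 2 else 3))"

text \<open>On one of the three edges the image runs out along a ray and back. On the other nine
  both minima at the ends vanish, which leaves an affine map.\<close>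

lemma fold_map_edge_pt:
  assumes "i \<noteq> j" "\<bar>s\<bar> = 1" "\<bar>s'\<bar> = 1" "0 \<le> t" "t \<le> 1"
  shows "fold_map r w (edge_pt i s j s' t) =
    (if fold_class i s = fold_class j s' then (r + min t (1 - t)) *\<^sub>R w (fold_class i s)
     else (r * (1 - t)) *\<^sub>R w (fold_class i s) + (r * t) *\<^sub>R w (fold_class j s'))"
proof -
  have "s = 1 \<or> s = - 1" "s' = 1 \<or> s' = - 1" "min 0 t = 0" "min t 0 = 0" "min 0 (1 - t) = 0" "min (1 - t) 0 = 0"
    using assms by auto
  then show ?thesis
    using exhaust_3[of i] exhaust_3[of j] assms(1,4,5)
    by (elim disjE) (simp_all add: fold_map_def fold_class_def bary_edge_pt min.commute add.commute)
qed

text \<open>The bound on \<open>w a\<close> makes the folds nonexpansive; the bound on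
  \<open>r * N (w a - w b)\<close> does the same for the other edges.\<close>

lemma map_rad_skeleton_ge_triangle:
  fixes N :: "'a::real_vector \<Rightarrow> real" and w :: "3 \<Rightarrow> 'a" and l :: "3 \<Rightarrow> 'a \<Rightarrow> real"
  assumes N: "is_norm N" and r: "0 \<le> r"
    and w: "\<And>a. N (w a) \<le> 1" "\<And>a b. a \<noteq> b \<Longrightarrow> r * N (w a - w b) \<le> 1"
    and l: "\<And>a. linear (l a)" "\<And>a x. l a x \<le> N x" "\<And>a. l a (w a) = 1" "\<And>x. l 1 x + l 2 x + l 3 x = 0"
  shows "ennreal (r + 1 / 2) \<le> map_rad octahedron_skeleton (arc_dist octahedron_skeleton) UNIV (\<lambda>x y. N (x - y))"
proof (rule map_rad_geI)
  show "fold_map r w \<in> Metr octahedron_skeleton (arc_dist octahedron_skeleton) UNIV (\<lambda>x y. N (x - y))"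
  proof (rule Metr_skeletonI)
    fix i j :: 3 and s s' t t' :: real
    assume e: "i \<noteq> j" "\<bar>s\<bar> = 1" "\<bar>s'\<bar> = 1" and t: "0 \<le> t" "t \<le> 1" "0 \<le> t'" "t' \<le> 1"
    let ?d = "fold_map r w (edge_pt i s j s' t) - fold_map r w (edge_pt i s j s' t')"
    show "N ?d \<le> \<bar>t - t'\<bar>"
    proof (cases "fold_class i s = fold_class j s'")
      case False
      let ?a = "w (fold_class i s)" and ?b = "w (fold_class j s')"
      have "?d = ((r * (1 - t)) *\<^sub>R ?a + (r * t) *\<^sub>R ?b) - ((r * (1 - t')) *\<^sub>R ?a + (r * t') *\<^sub>R ?b)"
        using False e t by (simp add: fold_map_edge_pt)
      also have "\<dots> = (r * (t' - t)) *\<^sub>R (?a - ?b)"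
        by (simp add: algebra_simps)
      finally have "N ?d = \<bar>t - t'\<bar> * (r * N (?a - ?b))"
        using r by (simp add: is_norm_scaleR[OF N] abs_mult abs_minus_commute)
      also have "\<dots> \<le> \<bar>t - t'\<bar>"
        using w(2)[OF False] by (simp add: mult_left_le)
      finally show ?thesis .
    next
      case True
      then have "?d = (min t (1 - t) - min t' (1 - t')) *\<^sub>R w (fold_class i s)"
        using e t by (simp add: fold_map_edge_pt flip: scaleR_diff_left)
      then have "N ?d \<le> \<bar>min t (1 - t) - min t' (1 - t')\<bar>"
        using w(1) by (simp add: is_norm_scaleR[OF N] mult_left_le)
      also have "\<dots> \<le> \<bar>t - t'\<bar>" by linarith
      finally show ?thesis .
    qed
  qed (rule is_norm_diff_triangle[OF N])
next
  fix y
  \<comment> \<open>Where the functional \<open>l a\<close> is nonpositive at the centre, it alone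
    detects the distance to the image of the midpoint. Since the three sum to 0, this happens for
    some \<open>a\<close>.\<close>
  have far: "r + 1 / 2 \<le> N ((r + 1 / 2) *\<^sub>R w a - y)" if "l a y \<le> 0" for a
  proof -
    have "r + 1 / 2 \<le> l a ((r + 1 / 2) *\<^sub>R w a - y)"
      using that by (simp add: linear_diff[OF l(1)] linear_scale[OF l(1)] l(3))
    also have "\<dots> \<le> N ((r + 1 / 2) *\<^sub>R w a - y)" by (rule l(2))
    finally show ?thesis .
  qed
  have mid: "fold_map r w (edge_pt 1 1 2 1 (1 / 2)) = (r + 1 / 2) *\<^sub>R w 1"
    "fold_map r w (edge_pt 1 (- 1) 3 1 (1 / 2)) = (r + 1 / 2) *\<^sub>R w 2"
    "fold_map r w (edge_pt 2 (- 1) 3 (- 1) (1 / 2)) = (r + 1 / 2) *\<^sub>R w 3"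
    by (simp_all add: fold_map_def bary_edge_pt)
  have "edge_pt 1 1 2 1 (1 / 2) \<in> octahedron_skeleton"
    "edge_pt 1 (- 1) 3 1 (1 / 2) \<in> octahedron_skeleton"
    "edge_pt 2 (- 1) 3 (- 1) (1 / 2) \<in> octahedron_skeleton"
    by (simp_all add: edge_pt_in_skeleton)
  moreover have "l 1 y \<le> 0 \<or> l 2 y \<le> 0 \<or> l 3 y \<le> 0"
    using l(4)[of y] by linarith
  ultimately show "\<exists>x\<in>octahedron_skeleton. r + 1 / 2 \<le> N (fold_map r w x - y)"
    using far mid by metis
qed

section \<open>The Euclidean and hexagonal lower bounds\<close>

text \<open>The \<open>w a\<close> form an equilateral triangle of side \<open>sqrt 3\<close>
  inscribed in the unit circle of a coordinate plane; the functionals are the inner products with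
  them.\<close>

lemma map_rad_skeleton_euclidean_ge:
  assumes "2 \<le> CARD('n::finite)"
  shows "ennreal (1 / sqrt 3 + 1 / 2)
    \<le> map_rad octahedron_skeleton (arc_dist octahedron_skeleton) (UNIV :: (real^'n) set) dist"
proof -
  obtain i j :: 'n where "i \<noteq> j"
    using assms by (metis card_2_iff' ex_card subset_UNIV)
  define u v :: "real^'n" where "u = axis i 1" and "v = axis j 1"
  have uv: "u \<bullet> u = 1" "v \<bullet> v = 1" "u \<bullet> v = 0" "v \<bullet> u = 0"
    using \<open>i \<noteq> j\<close> by (auto simp: u_def v_def inner_axis_axis)
  define w :: "3 \<Rightarrow> real^'n" where
    "w a = (if a = 1 then u else (- 1 / 2) *\<^sub>R u + ((if a = 2 then 1 else - 1) * sqrt 3 / 2) *\<^sub>R v)" for a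
  have inner_w: "w a \<bullet> w b = (if a = b then 1 else - 1 / 2)" for a b
    using exhaust_3[of a] exhaust_3[of b]
    by (elim disjE) (simp_all add: w_def inner_simps uv)
  have "norm (w a) = 1" for a
    by (simp add: norm_eq_sqrt_inner inner_w)
  moreover have "norm (w a - w b) = sqrt 3" if "a \<noteq> b" for a b
    using that by (simp add: norm_eq_sqrt_inner inner_diff inner_w)
  moreover have "w 1 \<bullet> x + w 2 \<bullet> x + w 3 \<bullet> x = 0" for x
    by (simp add: w_def inner_simps)
  moreover have "w a \<bullet> x \<le> norm (w a) * norm x" for a x
    by (rule norm_cauchy_schwarz)
  ultimately show ?thesis
    using map_rad_skeleton_ge_triangle[OF is_norm_norm, of "1 / sqrt 3" w "\<lambda>a x. w a \<bullet> x"]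
    by (simp add: inner_w dist_norm bounded_linear_inner_right bounded_linear.linear flip: dist_norm)
qed

text \<open>The rotation R by pi/3 satisfies R^2 = R - 1, as a primitive sixth root of unity does.
  So two consecutive vertices determine all six linearly.\<close>

lemma hexagon_vertex_Suc_Suc:
  "hexagon_vertex r \<theta> (Suc (Suc k)) = hexagon_vertex r \<theta> (Suc k) - hexagon_vertex r \<theta> k"
proof -
  define A where "A = \<theta> + k * pi / 3"
  have A: "\<theta> + real (Suc k) * pi / 3 = A + pi / 3" "\<theta> + real (Suc (Suc k)) * pi / 3 = (A + pi / 3) + pi / 3"
    by (simp_all add: A_def field_simps)
  have cs: "cos (A + pi / 3) = cos A / 2 - sqrt 3 / 2 * sin A" "sin (A + pi / 3) = sin A / 2 + sqrt 3 / 2 * cos A"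
    by (simp_all add: cos_add sin_add cos_60 sin_60)
  have sqrt3: "sqrt 3 * (sqrt 3 * z) = 3 * z" for z
    by (simp flip: mult.assoc)
  have "cos ((A + pi / 3) + pi / 3) = cos (A + pi / 3) - cos A"
    "sin ((A + pi / 3) + pi / 3) = sin (A + pi / 3) - sin A"
    unfolding cos_add[of "A + pi / 3"] sin_add[of "A + pi / 3"] cs cos_60 sin_60
    by (simp_all add: sqrt3 algebra_simps)
  then show ?thesis
    unfolding hexagon_vertex_def A by (simp add: vec_eq_iff forall_2 right_diff_distrib flip: A_def)
qed

lemma map_rad_skeleton_hexagon_ge:
  fixes N :: "real^2 \<Rightarrow> real"
  assumes N: "is_norm N" and hex: "regular_hexagon_at_origin {x. N x = 1}"
  shows "ennreal (7 / 6) \<le> map_rad octahedron_skeleton (arc_dist octahedron_skeleton) UNIV (\<lambda>x y. N (x - y))"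
proof -
  obtain r \<theta> where "r > 0" and
    H: "{x. N x = 1} = (\<Union>k<6. closed_segment (hexagon_vertex r \<theta> k) (hexagon_vertex r \<theta> (Suc k)))"
    using hex unfolding regular_hexagon_at_origin_def by auto
  define E where "E k = hexagon_vertex r \<theta> k" for k
  have H: "{x. N x = 1} = (\<Union>k<6. closed_segment (E k) (E (Suc k)))"
    using H unfolding E_def .
  define a b where "a = E 0" and "b = E 1"
  have E2: "E (Suc (Suc k)) = E (Suc k) - E k" for k
    unfolding E_def by (rule hexagon_vertex_Suc_Suc)
  have E: "E 0 = a" "E 1 = b" "E (Suc 0) = b" "E 2 = b - a" "E 3 = - a" "E 4 = - b" "E 5 = a - b" "E 6 = a"
    using E2[of 0] E2[of 1] E2[of 2] E2[of 3] E2[of 4]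
    by (simp_all add: a_def b_def numeral_eq_Suc)
  \<comment> \<open>The determinant of \<open>a\<close> and \<open>b\<close>, nonzero because
    consecutive vertices are at angle pi/3.\<close>
  define D where "D = a $ 1 * b $ 2 - a $ 2 * b $ 1"
  have "D = r\<^sup>2 * sin (pi / 3)"
  proof -
    have "sin (pi / 3) = sin (\<theta> + pi / 3) * cos \<theta> - cos (\<theta> + pi / 3) * sin \<theta>"
      using sin_diff[of "\<theta> + pi / 3" \<theta>] by simp
    then show ?thesis
      by (simp only: D_def a_def b_def E_def) (simp add: hexagon_vertex_def power2_eq_square right_diff_distrib)
  qed
  then have "D \<noteq> 0" using \<open>r > 0\<close> by (auto simp: sin_60)
  \<comment> \<open>The basis dual to \<open>a\<close>, \<open>b\<close>, by Cramer's rule.\<close>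
  define \<alpha> \<beta> where "\<alpha> x = (x $ 1 * b $ 2 - x $ 2 * b $ 1) / D" and "\<beta> x = (a $ 1 * x $ 2 - a $ 2 * x $ 1) / D"
    for x :: "real^2"
  have lin: "linear \<alpha>" "linear \<beta>"
    unfolding \<alpha>_def \<beta>_def by (auto intro!: linearI simp: algebra_simps add_divide_distrib diff_divide_distrib)
  have ab: "\<alpha> a = 1" "\<alpha> b = 0" "\<beta> a = 0" "\<beta> b = 1"
    using \<open>D \<noteq> 0\<close> by (simp_all add: \<alpha>_def \<beta>_def D_def)
  define w :: "3 \<Rightarrow> real^2" where
    "w c = (if c = 1 then (1/2) *\<^sub>R (E 0 + E 1) else if c = 2 then (1/2) *\<^sub>R (E 2 + E 3) else (1/2) *\<^sub>R (E 4 + E 5))" for c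
  \<comment> \<open>Each functional is constantly 1 on the side of the hexagon whose midpoint is
    \<open>w c\<close>.\<close>
  define l :: "3 \<Rightarrow> real^2 \<Rightarrow> real" where
    "l c = (if c = 1 then (\<lambda>x. \<alpha> x + \<beta> x) else if c = 2 then (\<lambda>x. - \<alpha> x) else (\<lambda>x. - \<beta> x))" for c
  have unit: "N x = 1" if "x \<in> closed_segment (E k) (E (Suc k))" "k < 6" for x k
    using H that by blast
  note hom = is_norm_scaleR[OF N]
  have lin_l: "linear (l c)" for c
    using lin by (auto simp: l_def intro: linear_compose_add linear_compose_neg)
  \<comment> \<open>The index 6 occurs as the successor of 5, the start of the last side.\<close>
  have l_vertex: "l c (E k) \<le> 1" if "k \<le> 6" for c k
  proof -
    have "k = 0 \<or> k = 1 \<or> k = 2 \<or> k = 3 \<or> k = 4 \<or> k = 5 \<or> k = 6"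
      using that by auto
    then show ?thesis
      by (elim disjE; simp only: E;
        simp add: l_def linear_diff[OF lin(1)] linear_diff[OF lin(2)]
          linear_neg[OF lin(1)] linear_neg[OF lin(2)] ab)
  qed
  \<comment> \<open>Scaling \<open>x\<close> to the unit circle puts it on a side, where a linear
    functional is at most its larger value at the two ends.\<close>
  have l_le: "l c x \<le> N x" for c x
  proof (cases "x = 0")
    case True
    then show ?thesis using is_norm_0[OF N] linear_0[OF lin_l] by simp
  next
    case False
    then have "N x > 0"
      using N is_norm_nonneg[OF N, of x] by (auto simp: is_norm_def order_less_le)
    then have "N ((1 / N x) *\<^sub>R x) = 1"
      by (simp add: hom)
    then obtain k where k: "k < 6" "(1 / N x) *\<^sub>R x \<in> closed_segment (E k) (E (Suc k))"
      using H by blast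
    then obtain u where u: "0 \<le> u" "u \<le> 1" "(1 / N x) *\<^sub>R x = (1 - u) *\<^sub>R E k + u *\<^sub>R E (Suc k)"
      unfolding closed_segment_def by auto
    have "l c ((1 / N x) *\<^sub>R x) = (1 - u) * l c (E k) + u * l c (E (Suc k))"
      unfolding u(3) by (simp add: linear_add[OF lin_l] linear_scale[OF lin_l])
    also have "\<dots> \<le> 1"
      using u k(1) l_vertex by (intro convex_bound_le) auto
    finally show ?thesis
      using \<open>N x > 0\<close> by (simp add: linear_scale[OF lin_l] field_simps)
  qed
  have mid: "(1/2) *\<^sub>R (p + q) \<in> closed_segment p q" for p q :: "real^2"
    using midpoint_in_closed_segment[of p q] by (simp add: midpoint_def)
  have w1: "N (w c) = 1" for c
    using unit[OF mid, of 0] unit[OF mid, of 2] unit[OF mid, of 4]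
    by (auto simp: w_def)
  have Nab: "N a = 1" "N b = 1" "N (b - a) = 1"
    using unit[of "E 0" 0] unit[of "E 1" 1] unit[of "E 2" 2] E by auto
  \<comment> \<open>The differences are 3/2 times a vertex up to sign, whence the choice r =
    2/3.\<close>
  have "w 1 - w 2 = (3/2) *\<^sub>R a" "w 1 - w 3 = (3/2) *\<^sub>R b" "w 2 - w 3 = (3/2) *\<^sub>R (b - a)"
    by (simp_all add: w_def E vec_eq_iff field_simps)
  then have "N (w 1 - w 2) = 3/2" "N (w 1 - w 3) = 3/2" "N (w 2 - w 3) = 3/2"
    by (simp_all only: hom Nab abs_numeral abs_divide mult_1_right)
  moreover from this have "N (w 2 - w 1) = 3/2" "N (w 3 - w 1) = 3/2" "N (w 3 - w 2) = 3/2"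
    using is_norm_minus[OF N] by (metis minus_diff_eq)+
  ultimately have w_diff: "N (w c - w c') = 3/2" if "c \<noteq> c'" for c c'
    using that exhaust_3[of c] exhaust_3[of c'] by auto
  \<comment> \<open>The product is componentwise here, so \<open>2 * a\<close> equals
    \<open>a + a\<close>.\<close>
  have "\<alpha> (2 * a) = 2" "\<beta> (2 * b) = 2"
    using linear_add[OF lin(1), of a a] linear_add[OF lin(2), of b b] ab by simp_all
  then have lw: "l c (w c) = 1" for c
    using exhaust_3[of c]
    by (auto simp: l_def w_def E linear_add[OF lin(1)] linear_add[OF lin(2)] linear_diff[OF lin(1)]
        linear_diff[OF lin(2)] linear_neg[OF lin(1)] linear_neg[OF lin(2)]
        linear_scale[OF lin(1)] linear_scale[OF lin(2)] ab)
  have "ennreal (2 / 3 + 1 / 2) \<le> map_rad octahedron_skeleton (arc_dist octahedron_skeleton) UNIV (\<lambda>x y. N (x - y))"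
  proof (rule map_rad_skeleton_ge_triangle[OF N, where w = w and l = l])
    show "2 / 3 * N (w c - w c') \<le> 1" if "c \<noteq> c'" for c c'
      using w_diff[OF that] by simp
    show "l 1 x + l 2 x + l 3 x = 0" for x
      by (simp add: l_def)
  qed (use w1 lin_l l_le lw in auto)
  then show ?thesis by simp
qed

theorem lemma4:
  shows "((\<exists>v::'v::real_normed_vector. v \<noteq> 0) \<longrightarrow>
            1 \<le> map_rad octahedron_skeleton (arc_dist octahedron_skeleton) (UNIV :: 'v set) dist \<and>
            map_rad octahedron_skeleton (arc_dist octahedron_skeleton) (UNIV :: 'v set) dist \<le> ennreal (7 / 6))
    \<and> (dim (UNIV :: 'v set) = 1 \<longrightarrow>
            map_rad octahedron_skeleton (arc_dist octahedron_skeleton) (UNIV :: 'v set) dist = 1)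
    \<and> (2 \<le> CARD('n::finite) \<longrightarrow>
            ennreal (1 / sqrt 3 + 1 / 2)
              \<le> map_rad octahedron_skeleton (arc_dist octahedron_skeleton) (UNIV :: (real^'n) set) dist)
    \<and> (\<forall>N :: real^2 \<Rightarrow> real. is_norm N \<and> regular_hexagon_at_origin {x. N x = 1} \<longrightarrow>
            map_rad octahedron_skeleton (arc_dist octahedron_skeleton) UNIV (\<lambda>x y. N (x - y))
              = ennreal (7 / 6))"
proof (intro conjI impI allI)
  assume "\<exists>v::'v. v \<noteq> 0"
  then show "1 \<le> map_rad octahedron_skeleton (arc_dist octahedron_skeleton) (UNIV :: 'v set) dist"
    using map_rad_skeleton_ge_1 by blast
  show "map_rad octahedron_skeleton (arc_dist octahedron_skeleton) (UNIV :: 'v set) dist \<le> ennreal (7 / 6)"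
    using map_rad_skeleton_le_7_6[OF is_norm_norm[where 'a = 'v]] by (simp flip: dist_norm)
next
  fix N :: "real^2 \<Rightarrow> real"
  assume "is_norm N \<and> regular_hexagon_at_origin {x. N x = 1}"
  then show "map_rad octahedron_skeleton (arc_dist octahedron_skeleton) UNIV (\<lambda>x y. N (x - y)) = ennreal (7 / 6)"
    using map_rad_skeleton_le_7_6 map_rad_skeleton_hexagon_ge by (intro antisym) auto
qed (rule map_rad_skeleton_dim_1 map_rad_skeleton_euclidean_ge, assumption)+

end
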